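(* Let $(S,\gamma,(L_x)_{x\in S},(\varphi_x^y)_{x\le_\gamma y})$ be a modular connected system and $x\le y$ in $S$. Define $\Phi_x^y:L_x\to L_y$ and $\Psi_x^y:L_y\to L_x$ by $\Phi_x^y(a)=\varphi_x^y(a\vee\hat0^y_x)$ if $x\,\gamma\,y$ and $\Phi_x^y(a)=\hat0_{L_y}$ otherwise; $\Psi_x^y(b)=(\varphi_x^y)^{-1}(b\wedge\hat1^y_x)$ if $x\,\gamma\,y$ and $\Psi_x^y(b)=\hat1_{L_x}$ otherwise. Then $\Phi_x^y$ and $\Psi_x^y$ are an adjoint pair of homomorphisms between $L_x$ and $L_y$; that is, for all $a\in L_x$ and $b\in L_y$, $\Phi_x^y(a)\le b$ if and only if $a\le\Psi_x^y(b)$.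
   Context: A lattice is l.f.f.c. if every closed interval is finite and every element has finitely many upper and lower covers. $x\lessdot y$ means $y$ covers $x$. A tolerance on a lattice $S$ is a reflexive, symmetric relation $\gamma$ with $a\,\gamma\,b$, $c\,\gamma\,d$ implying $(a\vee c)\,\gamma\,(b\vee d)$ and $(a\wedge c)\,\gamma\,(b\wedge d)$; $x\le_\gamma y$ means $x\le y$ and $x\,\gamma\,y$. A modular connected system $(S,\gamma,(L_x)_{x\in S},(\varphi_x^y)_{x\le_\gamma y})$ is a lattice $S$, a tolerance $\gamma$ on $S$, lattices $L_x$ and maps $\varphi_x^y$ satisfying: (MC1) $S$ is l.f.f.c.; (MC2) each $L_x$ is finite, modular, complemented; (MC3) each $\varphi_x^y$ is a lattice isomorphism from a nonempty lattice filter $F_x^y$ of $L_x$ onto a lattice ideal $I_x^y$ of $L_y$; (MC4) $F_x^x=I_x^x=L_x$, $\varphi_x^x=\mathrm{id}$; (MC5) if $x\le_\gamma y\le_\gamma z$ and $I_x^y\cap F_y^z\neq\emptyset$ then $x\,\gamma\,z$; (MC6) for $x\le z\le y$ with $x\,\gamma\,y$: $F_x^y=(\varphi_x^z)^{-1}(I_x^z\cap F_z^y)$, $I_x^y=\varphi_z^y(I_x^z\cap F_z^y)$, $\varphi_x^y=\varphi_z^y\circ\varphi_x^z|_{F_x^y}$; (MC7) if $x\,\gamma\,y$ then $I_x^{x\vee y}\cap I_y^{x\vee y}\subseteq I_{x\wedge y}^{x\vee y}$ and $F_{x\wedge y}^x\cap F_{x\wedge y}^y\subseteq F_{x\wedge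 y}^{x\vee y}$; (MC8.1) $x\lessdot y$ implies $x\,\gamma\,y$; (MC8.2) $x\lessdot y$ implies $F_x^y\neq L_x$ and $I_x^y\neq L_y$. For $x\le_\gamma y$, $\hat0^y_x$ denotes the minimum of $F_x^y$ and $\hat1^y_x$ the maximum of $I_x^y$; $\hat0_{L}$, $\hat1_{L}$ denote the minimum and maximum of a finite lattice $L$. *)

theory Defs
  imports "HOL-Algebra.Galois_Connection"
begin

section \<open>Lattice-theoretic notions\<close>

definition covers :: "('a, 'c) gorder_scheme \<Rightarrow> 'a \<Rightarrow> 'a \<Rightarrow> bool" where
  "covers S x y \<longleftrightarrow> x \<in> carrier S \<and> y \<in> carrier S \<and> x \<sqsubset>\<^bsub>S\<^esub> y \<and>
     \<not> (\<exists>z\<in>carrier S. x \<sqsubset>\<^bsub>S\<^esub> z \<and> z \<sqsubset>\<^bsub>S\<^esub> y)"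

definition lffc :: "('a, 'c) gorder_scheme \<Rightarrow> bool" where
  "lffc S \<longleftrightarrow>
     (\<forall>x\<in>carrier S. \<forall>y\<in>carrier S. finite (\<lbrace>x..y\<rbrace>\<^bsub>S\<^esub>)) \<and>
     (\<forall>x\<in>carrier S. finite {y. covers S x y} \<and> finite {y. covers S y x})"

definition modular :: "('a, 'c) gorder_scheme \<Rightarrow> bool" where
  "modular L \<longleftrightarrow> lattice L \<and>
     (\<forall>a\<in>carrier L. \<forall>b\<in>carrier L. \<forall>c\<in>carrier L.
        a \<sqsubseteq>\<^bsub>L\<^esub> c \<longrightarrow> a \<squnion>\<^bsub>L\<^esub> (b \<sqinter>\<^bsub>L\<^esub> c) = (a \<squnion>\<^bsub>L\<^esub> b) \<sqinter>\<^bsub>L\<^esub> c)"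

definition complemented :: "('a, 'c) gorder_scheme \<Rightarrow> bool" where
  "complemented L \<longleftrightarrow> bounded_lattice L \<and>
     (\<forall>a\<in>carrier L. \<exists>b\<in>carrier L. a \<squnion>\<^bsub>L\<^esub> b = \<top>\<^bsub>L\<^esub> \<and> a \<sqinter>\<^bsub>L\<^esub> b = \<bottom>\<^bsub>L\<^esub>)"

definition lattice_filter :: "('a, 'c) gorder_scheme \<Rightarrow> 'a set \<Rightarrow> bool" where
  "lattice_filter L F \<longleftrightarrow> F \<subseteq> carrier L \<and>
     (\<forall>a\<in>F. \<forall>b\<in>F. a \<sqinter>\<^bsub>L\<^esub> b \<in> F) \<and>
     (\<forall>a\<in>F. \<forall>b\<in>carrier L. a \<sqsubseteq>\<^bsub>L\<^esub> b \<longrightarrow> b \<in> F)"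

definition lattice_ideal :: "('a, 'c) gorder_scheme \<Rightarrow> 'a set \<Rightarrow> bool" where
  "lattice_ideal L I \<longleftrightarrow> I \<subseteq> carrier L \<and>
     (\<forall>a\<in>I. \<forall>b\<in>I. a \<squnion>\<^bsub>L\<^esub> b \<in> I) \<and>
     (\<forall>a\<in>I. \<forall>b\<in>carrier L. b \<sqsubseteq>\<^bsub>L\<^esub> a \<longrightarrow> b \<in> I)"

definition lattice_iso ::
  "('a, 'c) gorder_scheme \<Rightarrow> ('b, 'd) gorder_scheme \<Rightarrow> ('a \<Rightarrow> 'b) \<Rightarrow> bool" where
  "lattice_iso A B f \<longleftrightarrow>
     bij_betw f (carrier A) (carrier B) \<and> join_pres A B f \<and> meet_pres A B f"

definition minimum :: "('a, 'c) gorder_scheme \<Rightarrow> 'a set \<Rightarrow> 'a" where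
  "minimum L A = (THE m. least L m A)"

definition maximum :: "('a, 'c) gorder_scheme \<Rightarrow> 'a set \<Rightarrow> 'a" where
  "maximum L A = (THE m. greatest L m A)"

definition tolerance :: "('s, 'c) gorder_scheme \<Rightarrow> 's rel \<Rightarrow> bool" where
  "tolerance S \<gamma> \<longleftrightarrow>
     \<gamma> \<subseteq> carrier S \<times> carrier S \<and> refl_on (carrier S) \<gamma> \<and> sym \<gamma> \<and>
     (\<forall>a b c d. (a, b) \<in> \<gamma> \<longrightarrow> (c, d) \<in> \<gamma> \<longrightarrow>
        (a \<squnion>\<^bsub>S\<^esub> c, b \<squnion>\<^bsub>S\<^esub> d) \<in> \<gamma> \<and> (a \<sqinter>\<^bsub>S\<^esub> c, b \<sqinter>\<^bsub>S\<^esub> d) \<in> \<gamma>)"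

definition tol_le :: "('s, 'c) gorder_scheme \<Rightarrow> 's rel \<Rightarrow> 's \<Rightarrow> 's \<Rightarrow> bool" where
  "tol_le S \<gamma> x y \<longleftrightarrow> x \<in> carrier S \<and> y \<in> carrier S \<and> x \<sqsubseteq>\<^bsub>S\<^esub> y \<and> (x, y) \<in> \<gamma>"


section \<open>Modular connected systems\<close>

text \<open>
  HOL functions are total, so the partial map \<open>\<phi>\<^sub>x\<^sup>y\<close> is given by its domain \<open>F x y\<close>,
  its range \<open>I x y\<close> and a function \<open>\<phi> x y\<close> of which only the values on \<open>F x y\<close> matter.
  Nothing is required of \<open>F x y\<close>, \<open>I x y\<close>, \<open>\<phi> x y\<close> unless \<open>tol_le S \<gamma> x y\<close>.
  The lattices \<open>L x\<close> have different carriers inside one type \<open>'a\<close>.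
\<close>

locale modular_connected_system = lattice S
  for S :: "('s, 'c) gorder_scheme" (structure) +
  fixes \<gamma> :: "'s rel"
    and L :: "'s \<Rightarrow> 'a gorder"
    and F I :: "'s \<Rightarrow> 's \<Rightarrow> 'a set"
    and \<phi> :: "'s \<Rightarrow> 's \<Rightarrow> 'a \<Rightarrow> 'a"
  assumes tolerance: "tolerance S \<gamma>"
    and MC1: "lffc S"
    and MC2: "x \<in> carrier S \<Longrightarrow> finite (carrier (L x)) \<and> modular (L x) \<and> complemented (L x)"
    and MC3: "tol_le S \<gamma> x y \<Longrightarrow>
      F x y \<noteq> {} \<and> lattice_filter (L x) (F x y) \<and> lattice_ideal (L y) (I x y) \<and>
      lattice_iso ((L x)\<lparr>carrier := F x y\<rparr>) ((L y)\<lparr>carrier := I x y\<rparr>) (\<phi> x y)"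
    and MC4: "x \<in> carrier S \<Longrightarrow>
      F x x = carrier (L x) \<and> I x x = carrier (L x) \<and> (\<forall>a\<in>carrier (L x). \<phi> x x a = a)"
    and MC5: "\<lbrakk>tol_le S \<gamma> x y; tol_le S \<gamma> y z; I x y \<inter> F y z \<noteq> {}\<rbrakk> \<Longrightarrow> (x, z) \<in> \<gamma>"
    and MC6: "\<lbrakk>x \<in> carrier S; y \<in> carrier S; z \<in> carrier S; x \<sqsubseteq> z; z \<sqsubseteq> y; (x, y) \<in> \<gamma>\<rbrakk> \<Longrightarrow>
      F x y = {a \<in> F x z. \<phi> x z a \<in> I x z \<inter> F z y} \<and>
      I x y = \<phi> z y ` (I x z \<inter> F z y) \<and>
      (\<forall>a\<in>F x y. \<phi> x y a = \<phi> z y (\<phi> x z a))"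
    and MC7: "(x, y) \<in> \<gamma> \<Longrightarrow>
      I x (x \<squnion> y) \<inter> I y (x \<squnion> y) \<subseteq> I (x \<sqinter> y) (x \<squnion> y) \<and>
      F (x \<sqinter> y) x \<inter> F (x \<sqinter> y) y \<subseteq> F (x \<sqinter> y) (x \<squnion> y)"
    and MC8_1: "covers S x y \<Longrightarrow> (x, y) \<in> \<gamma>"
    and MC8_2: "covers S x y \<Longrightarrow> F x y \<noteq> carrier (L x) \<and> I x y \<noteq> carrier (L y)"

text \<open>For \<open>x \<sqsubseteq> y\<close> in \<open>S\<close>: the maps \<open>\<Phi>\<^sub>x\<^sup>y\<close> from \<open>L x\<close> to \<open>L y\<close> and \<open>\<Psi>\<^sub>x\<^sup>y\<close> from \<open>L y\<close> to \<open>L x\<close>.\<close>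

definition Phi ::
  "'s rel \<Rightarrow> ('s \<Rightarrow> 'a gorder) \<Rightarrow> ('s \<Rightarrow> 's \<Rightarrow> 'a set) \<Rightarrow> ('s \<Rightarrow> 's \<Rightarrow> 'a \<Rightarrow> 'a) \<Rightarrow>
   's \<Rightarrow> 's \<Rightarrow> 'a \<Rightarrow> 'a" where
  "Phi \<gamma> L F \<phi> x y a =
     (if (x, y) \<in> \<gamma> then \<phi> x y (a \<squnion>\<^bsub>L x\<^esub> minimum (L x) (F x y)) else \<bottom>\<^bsub>L y\<^esub>)"

definition Psi ::
  "'s rel \<Rightarrow> ('s \<Rightarrow> 'a gorder) \<Rightarrow> ('s \<Rightarrow> 's \<Rightarrow> 'a set) \<Rightarrow> ('s \<Rightarrow> 's \<Rightarrow> 'a set) \<Rightarrow>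
   ('s \<Rightarrow> 's \<Rightarrow> 'a \<Rightarrow> 'a) \<Rightarrow> 's \<Rightarrow> 's \<Rightarrow> 'a \<Rightarrow> 'a" where
  "Psi \<gamma> L F I \<phi> x y b =
     (if (x, y) \<in> \<gamma> then inv_into (F x y) (\<phi> x y) (b \<sqinter>\<^bsub>L y\<^esub> maximum (L y) (I x y))
      else \<top>\<^bsub>L x\<^esub>)"

text \<open>
  An adjoint pair of homomorphisms between lattices is a Galois connection, which contains the
  typing and the adjunction, whose maps are isotone.  The lower map preserves joins and the upper
  map preserves meets; in general neither is a homomorphism for both operations.
\<close>

definition adjoint_pair ::
  "'a gorder \<Rightarrow> 'b gorder \<Rightarrow> ('a \<Rightarrow> 'b) \<Rightarrow> ('b \<Rightarrow> 'a) \<Rightarrow> bool" where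
  "adjoint_pair A B f g \<longleftrightarrow>
     galois_connection \<lparr>orderA = A, orderB = B, lower = f, upper = g\<rparr> \<and>
     isotone A B f \<and> isotone B A g \<and> join_pres A B f \<and> meet_pres B A g"

end

(*
  The value f (a \<squnion> min F) lies in the ideal I, so it is below b iff it is below b \<sqinter> max I, which is f c
  for some c in the filter F.  An isomorphism reflects the order, so this says a \<squnion> min F \<sqsubseteq> c, that is,
  a \<sqsubseteq> c.  If x and y are not related by the tolerance, both sides of the equivalence hold.
*)
theory Submission
  imports Defs
begin

text \<open>Meeting the finitely many elements of \<open>A\<close> one after another never leaves
  \<open>A\<close>, so a common lower bound of all of them is itself a member.\<close>

lemma (in lattice) finite_meet_closed_least:
  assumes "finite A" "A \<noteq> {}" "A \<subseteq> carrier L"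
    and meet: "\<And>a b. a \<in> A \<Longrightarrow> b \<in> A \<Longrightarrow> a \<sqinter> b \<in> A"
  shows "\<exists>m. least L m A"
proof -
  \<comment> \<open>The bound \<open>m\<close> is sought in \<open>A\<close>, not in the subset
    \<open>B\<close>, since a subset of \<open>A\<close> need not be closed under meets. Taking
    \<open>B = A\<close> at the end yields the least element.\<close>
  have "\<exists>m\<in>A. \<forall>b\<in>B. m \<sqsubseteq> b" if "finite B" "B \<noteq> {}" "B \<subseteq> A" for B
    using that
  proof (induction rule: finite_ne_induct)
    case (singleton b)
    then have "b \<in> A" "b \<sqsubseteq> b" using assms(3) by auto
    then show ?case by auto
  next
    case (insert b B)
    then obtain m where m: "m \<in> A" "\<forall>c\<in>B. m \<sqsubseteq> c" by auto
    have b: "b \<in> A" using insert.prems by simp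
    have carr: "m \<in> carrier L" "b \<in> carrier L" "B \<subseteq> carrier L"
      using m(1) b insert.prems assms(3) by auto
    have "m \<sqinter> b \<sqsubseteq> c" if "c \<in> B" for c
    proof (rule le_trans)
      show "m \<sqinter> b \<sqsubseteq> m" using carr by (intro meet_left)
      show "m \<sqsubseteq> c" using m(2) that by blast
    qed (use carr that in auto)
    moreover have "m \<sqinter> b \<sqsubseteq> b" using carr by (intro meet_right)
    ultimately show ?case using meet[OF m(1) b] by blast
  qed
  from this[OF assms(1,2)] show ?thesis using assms(3) by (auto simp: least_def)
qed

text \<open>\<open>minimum\<close> is a definite description. Existence is assumed, and antisymmetry
  makes the least element unique.\<close>

lemma (in partial_order) least_minimum:
  assumes "\<exists>m. least L m A"
  shows "least L (minimum L A) A"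
  unfolding minimum_def using assms by (metis theI least_unique)

lemma (in lattice) filter_least_minimum:
  assumes "finite (carrier L)" "lattice_filter L A" "A \<noteq> {}"
  shows "least L (minimum L A) A"
proof (intro least_minimum finite_meet_closed_least)
  show "A \<subseteq> carrier L" using assms(2) by (simp add: lattice_filter_def)
  then show "finite A" using assms(1) by (rule finite_subset)
qed (use assms in \<open>auto simp: lattice_filter_def\<close>)

text \<open>Ideals are the filters of the order dual, so this is the preceding fact read in
  \<open>inv_gorder L\<close>.\<close>

lemma (in lattice) ideal_greatest_maximum:
  assumes "finite (carrier L)" "lattice_ideal L A" "A \<noteq> {}"
  shows "greatest L (maximum L A) A"
proof -
  interpret dual: lattice "inv_gorder L" by (rule dual_lattice)
  have "lattice_filter (inv_gorder L) A"
    using assms(2) by (simp add: lattice_filter_def lattice_ideal_def)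
  then have "least (inv_gorder L) (minimum (inv_gorder L) A) A"
    using assms(1,3) by (intro dual.filter_least_minimum) simp_all
  \<comment> \<open>Least elements of the dual are greatest elements of \<open>L\<close>, so both
    descriptions unfold to the same term.\<close>
  then show ?thesis by (simp add: minimum_def maximum_def)
qed

text \<open>\<open>lattice_iso\<close> speaks of bijectivity and the operations. The order is
  recovered from the join, and injectivity of \<open>f\<close> lets the equation between joins be
  pulled back.\<close>

lemma lattice_iso_le_iff:
  assumes iso: "lattice_iso A B f" and "a \<in> carrier A" "b \<in> carrier A"
  shows "f a \<sqsubseteq>\<^bsub>B\<^esub> f b \<longleftrightarrow> a \<sqsubseteq>\<^bsub>A\<^esub> b"
proof -
  interpret A: lattice A using iso by (simp add: lattice_iso_def join_pres_def)
  interpret B: lattice B using iso by (simp add: lattice_iso_def join_pres_def)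
  have bij: "bij_betw f (carrier A) (carrier B)"
    and join: "f (a \<squnion>\<^bsub>A\<^esub> b) = f a \<squnion>\<^bsub>B\<^esub> f b"
    using assms by (auto simp: lattice_iso_def join_pres_def)
  have "f a \<in> carrier B" "f b \<in> carrier B"
    using bij assms(2,3) by (auto simp: bij_betw_def)
  \<comment> \<open>Despite its name, \<open>le_iff_meet\<close> characterises the order by
    joins.\<close>
  then have "f a \<sqsubseteq>\<^bsub>B\<^esub> f b \<longleftrightarrow> f (a \<squnion>\<^bsub>A\<^esub> b) = f b"
    by (simp add: B.le_iff_meet join)
  also have "\<dots> \<longleftrightarrow> a \<squnion>\<^bsub>A\<^esub> b = b"
    using bij assms(2,3) by (intro inj_on_eq_iff[of f "carrier A"]) (auto simp: bij_betw_def)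
  also have "\<dots> \<longleftrightarrow> a \<sqsubseteq>\<^bsub>A\<^esub> b"
    using assms(2,3) by (simp add: A.le_iff_meet)
  finally show ?thesis .
qed

text \<open>Lower adjoints preserve joins and upper adjoints preserve meets, so typing and the
  adjunction already give everything that \<open>adjoint_pair\<close> demands.\<close>

lemma adjoint_pairI:
  assumes "lattice A" "lattice B"
    and f: "\<And>a. a \<in> carrier A \<Longrightarrow> f a \<in> carrier B"
    and g: "\<And>b. b \<in> carrier B \<Longrightarrow> g b \<in> carrier A"
    and adj: "\<And>a b. a \<in> carrier A \<Longrightarrow> b \<in> carrier B \<Longrightarrow> f a \<sqsubseteq>\<^bsub>B\<^esub> b \<longleftrightarrow> a \<sqsubseteq>\<^bsub>A\<^esub> g b"
  shows "adjoint_pair A B f g"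
proof -
  interpret A: lattice A by fact
  interpret B: lattice B by fact
  let ?G = "\<lparr>orderA = A, orderB = B, lower = f, upper = g\<rparr>"
  interpret G: galois_connection ?G
    by (intro galois_connection.intro connection.intro galois_connection_axioms.intro)
      (use f g adj A.partial_order_axioms B.partial_order_axioms in auto)
  have iso_f: "isotone A B f" and iso_g: "isotone B A g"
    using G.lower_iso G.upper_iso by simp_all
  have "f (a \<squnion>\<^bsub>A\<^esub> b) = f a \<squnion>\<^bsub>B\<^esub> f b" if ab: "a \<in> carrier A" "b \<in> carrier A" for a b
  proof (rule B.le_antisym)
    \<comment> \<open>Both \<open>f a\<close> and \<open>f b\<close> lie below their join.
      Transposing moves this to \<open>A\<close>, where the two bounds combine into one on the join
      of \<open>a\<close> and \<open>b\<close>, which is then transposed back.\<close>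
    have "a \<sqsubseteq>\<^bsub>A\<^esub> g (f a \<squnion>\<^bsub>B\<^esub> f b)" "b \<sqsubseteq>\<^bsub>A\<^esub> g (f a \<squnion>\<^bsub>B\<^esub> f b)"
      using ab f by (simp_all add: adj[symmetric] B.join_left B.join_right)
    then have "a \<squnion>\<^bsub>A\<^esub> b \<sqsubseteq>\<^bsub>A\<^esub> g (f a \<squnion>\<^bsub>B\<^esub> f b)"
      using ab f g by (intro A.join_le) auto
    then show "f (a \<squnion>\<^bsub>A\<^esub> b) \<sqsubseteq>\<^bsub>B\<^esub> f a \<squnion>\<^bsub>B\<^esub> f b" using ab f by (simp add: adj)
    show "f a \<squnion>\<^bsub>B\<^esub> f b \<sqsubseteq>\<^bsub>B\<^esub> f (a \<squnion>\<^bsub>A\<^esub> b)"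
      using ab f by (intro B.join_le use_iso2[OF iso_f] A.join_left A.join_right) auto
  qed (use ab f in auto)
  moreover have "g (a \<sqinter>\<^bsub>B\<^esub> b) = g a \<sqinter>\<^bsub>A\<^esub> g b" if ab: "a \<in> carrier B" "b \<in> carrier B" for a b
  proof (rule A.le_antisym)
    have "f (g a \<sqinter>\<^bsub>A\<^esub> g b) \<sqsubseteq>\<^bsub>B\<^esub> a" "f (g a \<sqinter>\<^bsub>A\<^esub> g b) \<sqsubseteq>\<^bsub>B\<^esub> b"
      using ab g by (simp_all add: adj A.meet_left A.meet_right)
    then have "f (g a \<sqinter>\<^bsub>A\<^esub> g b) \<sqsubseteq>\<^bsub>B\<^esub> a \<sqinter>\<^bsub>B\<^esub> b"
      using ab f g by (intro B.meet_le) auto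
    then show "g a \<sqinter>\<^bsub>A\<^esub> g b \<sqsubseteq>\<^bsub>A\<^esub> g (a \<sqinter>\<^bsub>B\<^esub> b)" using ab g by (simp add: adj)
    show "g (a \<sqinter>\<^bsub>B\<^esub> b) \<sqsubseteq>\<^bsub>A\<^esub> g a \<sqinter>\<^bsub>A\<^esub> g b"
      using ab g by (intro A.meet_le use_iso2[OF iso_g] B.meet_left B.meet_right) auto
  qed (use ab g in auto)
  ultimately show ?thesis
    unfolding adjoint_pair_def join_pres_def meet_pres_def
    using G.galois_connection_axioms iso_f iso_g assms(1,2) by blast
qed

text \<open>Three adjunctions are composed: joining with \<open>m\<close> is lower adjoint to the
  inclusion of \<open>F\<close> in \<open>A\<close>, \<open>f\<close> is lower adjoint to its
  inverse, and the inclusion of \<open>I\<close> in \<open>B\<close> is lower adjoint to meeting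
  with \<open>M\<close>.\<close>

lemma filter_ideal_iso_adjoint:
  assumes "lattice A" "lattice B"
    and F: "lattice_filter A F" "least A m F"
    and I: "lattice_ideal B I" "greatest B M I"
    and iso: "lattice_iso (A\<lparr>carrier := F\<rparr>) (B\<lparr>carrier := I\<rparr>) f"
    and a: "a \<in> carrier A" and b: "b \<in> carrier B"
  shows "f (a \<squnion>\<^bsub>A\<^esub> m) \<in> carrier B"
    and "inv_into F f (b \<sqinter>\<^bsub>B\<^esub> M) \<in> carrier A"
    and "f (a \<squnion>\<^bsub>A\<^esub> m) \<sqsubseteq>\<^bsub>B\<^esub> b \<longleftrightarrow> a \<sqsubseteq>\<^bsub>A\<^esub> inv_into F f (b \<sqinter>\<^bsub>B\<^esub> M)"
proof -
  interpret A: lattice A by fact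
  interpret B: lattice B by fact
  have bij: "bij_betw f F I" using iso by (simp add: lattice_iso_def)
  have sub: "F \<subseteq> carrier A" "I \<subseteq> carrier B"
    using F(1) I(1) by (auto simp: lattice_filter_def lattice_ideal_def)
  have m: "m \<in> F" "m \<in> carrier A" and M: "M \<in> I" "M \<in> carrier B"
    using least_mem[OF F(2)] greatest_mem[OF I(2)] sub by auto
  let ?j = "a \<squnion>\<^bsub>A\<^esub> m" and ?k = "b \<sqinter>\<^bsub>B\<^esub> M"
  let ?c = "inv_into F f ?k"
  have carr: "?j \<in> carrier A" "?k \<in> carrier B" using a b m M by simp_all
  have j: "?j \<in> F"
    using F(1) m carr(1) A.join_right[OF a m(2)] unfolding lattice_filter_def by blast
  have k: "?k \<in> I"
    using I(1) M carr(2) B.meet_right[OF b M(2)] unfolding lattice_ideal_def by blast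
  have fj: "f ?j \<in> I" using bij j by (auto simp: bij_betw_def)
  \<comment> \<open>\<open>inv_into\<close> is a genuine inverse at \<open>?k\<close> because
    \<open>?k\<close> lies in the image \<open>I\<close> of \<open>F\<close>.\<close>
  have c: "?c \<in> F" and fc: "f ?c = ?k"
    using bij k by (auto simp: bij_betw_def inv_into_into f_inv_into_f)
  show "f ?j \<in> carrier B" "?c \<in> carrier A" using fj c sub by auto
  have "f ?j \<sqsubseteq>\<^bsub>B\<^esub> M" using greatest_le[OF I(2) fj] .
  then have "f ?j \<sqsubseteq>\<^bsub>B\<^esub> b \<longleftrightarrow> f ?j \<sqsubseteq>\<^bsub>B\<^esub> ?k"
    using b M carr fj sub by (meson B.le_trans B.meet_le B.meet_left subsetD)
  \<comment> \<open>Replacing the carrier leaves the order relation unchanged, so the comparison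
    inside \<open>F\<close> and \<open>I\<close> is the one in \<open>A\<close> and
    \<open>B\<close>.\<close>
  also have "\<dots> \<longleftrightarrow> ?j \<sqsubseteq>\<^bsub>A\<^esub> ?c"
    using lattice_iso_le_iff[OF iso, of ?j ?c] j c fc by simp
  also have "\<dots> \<longleftrightarrow> a \<sqsubseteq>\<^bsub>A\<^esub> ?c"
    using a m carr c sub least_le[OF F(2) c]
    by (meson A.le_trans A.join_le A.join_left subsetD)
  finally show "f ?j \<sqsubseteq>\<^bsub>B\<^esub> b \<longleftrightarrow> a \<sqsubseteq>\<^bsub>A\<^esub> ?c" .
qed

theorem theorem4p73:
  fixes S :: "('s, 'c) gorder_scheme"
    and \<gamma> :: "'s rel"
    and L :: "'s \<Rightarrow> 'a gorder"
    and F I :: "'s \<Rightarrow> 's \<Rightarrow> 'a set"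
    and \<phi> :: "'s \<Rightarrow> 's \<Rightarrow> 'a \<Rightarrow> 'a"
    and x y :: 's
  assumes "modular_connected_system S \<gamma> L F I \<phi>"
    and "x \<in> carrier S" and "y \<in> carrier S" and "x \<sqsubseteq>\<^bsub>S\<^esub> y"
  shows "adjoint_pair (L x) (L y) (Phi \<gamma> L F \<phi> x y) (Psi \<gamma> L F I \<phi> x y) \<and>
    (\<forall>a\<in>carrier (L x). \<forall>b\<in>carrier (L y).
       Phi \<gamma> L F \<phi> x y a \<sqsubseteq>\<^bsub>L y\<^esub> b \<longleftrightarrow> a \<sqsubseteq>\<^bsub>L x\<^esub> Psi \<gamma> L F I \<phi> x y b)"
proof -
  interpret modular_connected_system S \<gamma> L F I \<phi> by fact
  interpret A: bounded_lattice "L x" using MC2[OF assms(2)] by (simp add: complemented_def)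
  interpret B: bounded_lattice "L y" using MC2[OF assms(3)] by (simp add: complemented_def)
  have *: "Phi \<gamma> L F \<phi> x y a \<in> carrier (L y) \<and> Psi \<gamma> L F I \<phi> x y b \<in> carrier (L x) \<and>
      (Phi \<gamma> L F \<phi> x y a \<sqsubseteq>\<^bsub>L y\<^esub> b \<longleftrightarrow> a \<sqsubseteq>\<^bsub>L x\<^esub> Psi \<gamma> L F I \<phi> x y b)"
    if ab: "a \<in> carrier (L x)" "b \<in> carrier (L y)" for a b
  proof (cases "(x, y) \<in> \<gamma>")
    case True
    then have "tol_le S \<gamma> x y" using assms(2-4) by (simp add: tol_le_def)
    note mc3 = MC3[OF this]
    \<comment> \<open>Nonemptiness is stated for the filter and passes to the ideal along the
      bijection.\<close>
    then have "I x y \<noteq> {}" by (auto simp: lattice_iso_def bij_betw_def)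
    then have max: "greatest (L y) (maximum (L y) (I x y)) (I x y)"
      using mc3 MC2[OF assms(3)] by (intro B.ideal_greatest_maximum) auto
    have min: "least (L x) (minimum (L x) (F x y)) (F x y)"
      using mc3 MC2[OF assms(2)] by (intro A.filter_least_minimum) auto
    show ?thesis
      using filter_ideal_iso_adjoint[OF A.lattice_axioms B.lattice_axioms _ min _ max _ ab] mc3 True
      by (simp add: Phi_def Psi_def)
  next
    case False
    then show ?thesis using ab by (simp add: Phi_def Psi_def)
  qed
  have "adjoint_pair (L x) (L y) (Phi \<gamma> L F \<phi> x y) (Psi \<gamma> L F I \<phi> x y)"
  proof (rule adjoint_pairI)
    show "lattice (L x)" "lattice (L y)" by unfold_locales
  \<comment> \<open>\<open>*\<close> takes an element of each lattice at once, so typing one map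
    requires some element of the other lattice; the bottoms serve as these partners.\<close>
  qed (use * A.bottom_closed B.bottom_closed in blast)+
  with * show ?thesis by blast
qed

end
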